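(* Let $\beta\in\mathbb{N}=\{0,1,2,\dots\}$ and $\alpha\in\mathbb{D}\setminus\{0\}$. Let $\phi_\alpha(z)=\dfrac{\alpha-z}{1-\overline{\alpha}z}$, let $\lambda\in\mathbb{T}$, and let $\phi=\phi_\alpha\circ(\lambda\phi_\alpha)$ be an elliptic automorphism of $\mathbb{D}$ (not a rotation) of finite order $N$, i.e. $N$ is the smallest positive integer with $\lambda^N=1$. If $N\ge 2(3+\beta)$, then the composition operator $C_\phi f=f\circ\phi$ is not complex symmetric on $A^2_\beta$.
   Context: $\mathbb{D}$ is the open unit disc and $\mathbb{T}$ the unit circle. For $\beta>-1$, $A^2_\beta$ is the Hilbert space of analytic functions $f(z)=\sum_{n\ge0}\widehat f(n)z^n$ on $\mathbb{D}$ with inner product $\langle f,g\rangle=\sum_{n\ge0}\frac{n!\,\Gamma(2+\beta)}{\Gamma(n+2+\beta)}\widehat f(n)\overline{\widehat g(n)}$ (equivalently the $L^2$ inner product with respect to $(\beta+1)(1-|z|^2)^\beta dA(z)$). A conjugation is a conjugate-linear map $C$ with $C^2=I$ and $\langle Cf,Cg\rangle=\langle g,f\rangle$; a bounded operator $T$ is complex symmetric if $CT=T^*C$ for some conjugation $C$. A rotation is a map $z\mapsto\mu z$ with $\mu\in\mathbb{T}$. *)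

theory Defs
  imports "HOL-Analysis.Analysis"
begin

abbreviation unit_disc :: "complex set" where
  "unit_disc \<equiv> ball 0 1"

definition taylor_coeff :: "(complex \<Rightarrow> complex) \<Rightarrow> nat \<Rightarrow> complex" where
  "taylor_coeff f n = (deriv ^^ n) f 0 / of_nat (fact n)"

definition bergman_weight :: "real \<Rightarrow> nat \<Rightarrow> real" where
  "bergman_weight \<beta> n = fact n * Gamma (2 + \<beta>) / Gamma (real n + 2 + \<beta>)"

text \<open>The weighted Bergman space A^2_beta (functions analytic on the disc with
  finite norm). Elements are identified when they agree on the disc.\<close>
definition A2 :: "real \<Rightarrow> (complex \<Rightarrow> complex) set" where
  "A2 \<beta> = {f. f holomorphic_on unit_disc \<and>
               summable (\<lambda>n. bergman_weight \<beta> n * (norm (taylor_coeff f n))\<^sup>2)}"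

definition A2_inner :: "real \<Rightarrow> (complex \<Rightarrow> complex) \<Rightarrow> (complex \<Rightarrow> complex) \<Rightarrow> complex" where
  "A2_inner \<beta> f g = (\<Sum>n. of_real (bergman_weight \<beta> n) * taylor_coeff f n * cnj (taylor_coeff g n))"

definition eq_disc :: "(complex \<Rightarrow> complex) \<Rightarrow> (complex \<Rightarrow> complex) \<Rightarrow> bool" where
  "eq_disc f g \<longleftrightarrow> (\<forall>z\<in>unit_disc. f z = g z)"

definition is_conjugation ::
  "real \<Rightarrow> ((complex \<Rightarrow> complex) \<Rightarrow> (complex \<Rightarrow> complex)) \<Rightarrow> bool" where
  "is_conjugation \<beta> C \<longleftrightarrow>
     (\<forall>f\<in>A2 \<beta>. C f \<in> A2 \<beta>) \<and>
     (\<forall>f\<in>A2 \<beta>. \<forall>g\<in>A2 \<beta>. eq_disc f g \<longrightarrow> eq_disc (C f) (C g)) \<and>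
     (\<forall>f\<in>A2 \<beta>. \<forall>g\<in>A2 \<beta>. eq_disc (C (\<lambda>z. f z + g z)) (\<lambda>z. C f z + C g z)) \<and>
     (\<forall>f\<in>A2 \<beta>. \<forall>a. eq_disc (C (\<lambda>z. a * f z)) (\<lambda>z. cnj a * C f z)) \<and>
     (\<forall>f\<in>A2 \<beta>. eq_disc (C (C f)) f) \<and>
     (\<forall>f\<in>A2 \<beta>. \<forall>g\<in>A2 \<beta>. A2_inner \<beta> (C f) (C g) = A2_inner \<beta> g f)"

definition is_adjoint ::
  "real \<Rightarrow> ((complex \<Rightarrow> complex) \<Rightarrow> (complex \<Rightarrow> complex))
        \<Rightarrow> ((complex \<Rightarrow> complex) \<Rightarrow> (complex \<Rightarrow> complex)) \<Rightarrow> bool" where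
  "is_adjoint \<beta> T S \<longleftrightarrow>
     (\<forall>g\<in>A2 \<beta>. S g \<in> A2 \<beta>) \<and>
     (\<forall>f\<in>A2 \<beta>. \<forall>g\<in>A2 \<beta>. A2_inner \<beta> (T f) g = A2_inner \<beta> f (S g))"

definition complex_symmetric ::
  "real \<Rightarrow> ((complex \<Rightarrow> complex) \<Rightarrow> (complex \<Rightarrow> complex)) \<Rightarrow> bool" where
  "complex_symmetric \<beta> T \<longleftrightarrow>
     (\<exists>C S. is_conjugation \<beta> C \<and> is_adjoint \<beta> T S \<and>
            (\<forall>f\<in>A2 \<beta>. eq_disc (C (T f)) (S (C f))))"

definition phi_aut :: "complex \<Rightarrow> complex \<Rightarrow> complex" where
  "phi_aut \<alpha> z = (\<alpha> - z) / (1 - cnj \<alpha> * z)"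

end

theory Submission
  imports Defs "HOL-Complex_Analysis.Complex_Analysis"
begin

text \<open>
  Put \<open>d = \<beta> + 2\<close>. A conjugation intertwining the composition operator with its adjoint maps
  each power \<open>\<phi>\<^sub>\<alpha>\<^sup>m\<close>, an eigenvector for \<open>\<lambda>\<^sup>m\<close>, to an eigenvector \<open>v\<^sub>m\<close> of the adjoint for the
  conjugate eigenvalue, which is therefore orthogonal to \<open>\<phi>\<^sub>\<alpha>\<^sup>n\<close> unless \<open>\<lambda>\<^sup>n = \<lambda>\<^sup>m\<close>. The functions
  \<open>e\<^sub>n = (1 - cnj \<alpha> \<phi>\<^sub>\<alpha>)\<^sup>d \<phi>\<^sub>\<alpha>\<^sup>n\<close> are scalar multiples of the images of the monomials under the unitary
  weighted composition operator attached to \<open>\<phi>\<^sub>\<alpha>\<close>, so they form a complete orthogonal system; since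
  \<open>\<beta>\<close> is a natural number, \<open>e\<^sub>n\<close> is a combination of only \<open>\<phi>\<^sub>\<alpha>\<^sup>n, \<dots>, \<phi>\<^sub>\<alpha>\<^bsup>n+d\<^esup>\<close>. As \<open>N \<ge> 2(d + 1)\<close>,
  no \<open>e\<^sub>n\<close> has nonzero inner product with both \<open>v\<^sub>0\<close> and \<open>v\<^bsub>d+1\<^esub>\<close>, hence these are orthogonal. But their
  inner product is that of \<open>1\<close> and \<open>\<phi>\<^sub>\<alpha>\<^bsup>d+1\<^esup>\<close>, which is \<open>cnj \<alpha>\<^bsup>d+1\<^esup> \<noteq> 0\<close>.
\<close>

section \<open>Matrices with orthonormal columns\<close>

lemma sum_mult_le_L2:
  fixes f g :: "'a \<Rightarrow> real"
  assumes "\<And>i. i \<in> I \<Longrightarrow> 0 \<le> f i" "\<And>i. i \<in> I \<Longrightarrow> 0 \<le> g i"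
    and "(\<Sum>i\<in>I. (f i)\<^sup>2) \<le> X" and "(\<Sum>i\<in>I. (g i)\<^sup>2) \<le> Y"
  shows "(\<Sum>i\<in>I. f i * g i) \<le> sqrt X * sqrt Y"
proof -
  have "(\<Sum>i\<in>I. f i * g i)\<^sup>2 \<le> (\<Sum>i\<in>I. (f i)\<^sup>2) * (\<Sum>i\<in>I. (g i)\<^sup>2)"
    by (rule Cauchy_Schwarz_ineq_sum)
  also have "\<dots> \<le> X * Y"
    by (rule mult_mono[OF assms(3,4) order_trans[OF _ assms(3)]]) (simp_all add: sum_nonneg)
  finally have "sqrt ((\<Sum>i\<in>I. f i * g i)\<^sup>2) \<le> sqrt (X * Y)"
    by (rule real_sqrt_le_mono)
  then show ?thesis
    by (simp add: real_sqrt_mult)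
qed

lemma summable_mult_of_square_summable:
  fixes x y :: "nat \<Rightarrow> complex"
  assumes "summable (\<lambda>i. (norm (x i))\<^sup>2)" "summable (\<lambda>i. (norm (y i))\<^sup>2)"
  shows "summable (\<lambda>i. x i * y i)"
proof (rule summable_norm_cancel, rule summable_comparison_test)
  show "summable (\<lambda>i. (norm (x i))\<^sup>2 + (norm (y i))\<^sup>2)"
    using assms by (rule summable_add)
  have "norm (x i) * norm (y i) \<le> (norm (x i))\<^sup>2 + (norm (y i))\<^sup>2" for i
    using sum_squares_bound[of "norm (x i)" "norm (y i)"]
      mult_nonneg_nonneg[OF norm_ge_zero[of "x i"] norm_ge_zero[of "y i"]]
    by linarith
  then show "\<exists>N. \<forall>n\<ge>N. norm (norm (x n * y n)) \<le> (norm (x n))\<^sup>2 + (norm (y n))\<^sup>2"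
    by (simp add: norm_mult)
qed

context
  fixes Q :: "nat \<Rightarrow> nat \<Rightarrow> complex"
  assumes cols: "\<And>i j. (\<lambda>n. Q n i * cnj (Q n j)) sums (if i = j then 1 else 0)"
    and rows: "\<And>n. summable (\<lambda>i. (norm (Q n i))\<^sup>2)"
begin

text \<open>For fixed n, the sum of \<open>Q n i * cnj (x i)\<close> is the inner product of row n
  with \<open>x\<close>. Expanding the product of two such sums and summing over n, only the
  diagonal terms survive, by orthonormality of the columns. So pairing with the rows is isometric on
  finitely supported vectors.\<close>

lemma finite_parseval:
  assumes "finite I"
  shows "(\<lambda>n. (\<Sum>i\<in>I. Q n i * cnj (x i)) * cnj (\<Sum>i\<in>I. Q n i * cnj (y i)))
     sums (\<Sum>i\<in>I. cnj (x i) * y i)"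
proof -
  have "(\<lambda>n. \<Sum>i\<in>I. \<Sum>j\<in>I. cnj (x i) * y j * (Q n i * cnj (Q n j)))
     sums (\<Sum>i\<in>I. \<Sum>j\<in>I. cnj (x i) * y j * (if i = j then 1 else 0))"
    by (intro sums_sum sums_mult cols)
  moreover have "(\<Sum>i\<in>I. \<Sum>j\<in>I. cnj (x i) * y j * (if i = j then 1 else 0)) = (\<Sum>i\<in>I. cnj (x i) * y i)"
    using assms by (simp add: if_distrib cong: if_cong)
  moreover have "(\<lambda>n. \<Sum>i\<in>I. \<Sum>j\<in>I. cnj (x i) * y j * (Q n i * cnj (Q n j)))
     = (\<lambda>n. (\<Sum>i\<in>I. Q n i * cnj (x i)) * cnj (\<Sum>i\<in>I. Q n i * cnj (y i)))"
    unfolding cnj_sum sum_product by (simp only: complex_cnj_mult complex_cnj_cnj mult_ac)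
  ultimately show ?thesis by simp
qed

lemma finite_bessel:
  assumes "finite I"
  shows "(\<Sum>n<K. (norm (\<Sum>i\<in>I. Q n i * cnj (x i)))\<^sup>2) \<le> (\<Sum>i\<in>I. (norm (x i))\<^sup>2)"
proof -
  have "(\<lambda>n. complex_of_real ((norm (\<Sum>i\<in>I. Q n i * cnj (x i)))\<^sup>2))
     sums complex_of_real (\<Sum>i\<in>I. (norm (x i))\<^sup>2)"
    using finite_parseval[OF assms, of x x]
    by (simp only: of_real_sum complex_norm_square mult.commute[of "cnj _"])
  then have *: "(\<lambda>n. (norm (\<Sum>i\<in>I. Q n i * cnj (x i)))\<^sup>2) sums (\<Sum>i\<in>I. (norm (x i))\<^sup>2)"
    by (simp only: sums_of_real_iff)
  show ?thesis
    using sum_le_suminf[OF sums_summable[OF *], of "{..<K}"] sums_unique[OF *] by simp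
qed

lemma rows_sums:
  assumes "summable (\<lambda>i. (norm (x i))\<^sup>2)"
  shows "(\<lambda>i. Q n i * cnj (x i)) sums (\<Sum>i. Q n i * cnj (x i))"
  by (rule summable_sums, rule summable_mult_of_square_summable) (use rows assms in auto)

text \<open>The square-summable rows make each full pairing the limit of its truncations. Since only
  finitely many n are summed, the limit \<open>L\<close> to infinity may be taken inside
  \<open>finite_bessel\<close> applied to the indices from \<open>M\<close> up to
  \<open>L\<close>.\<close>

lemma bessel_tail:
  assumes x: "summable (\<lambda>i. (norm (x i))\<^sup>2)"
  shows "(\<Sum>n<K. (norm ((\<Sum>i. Q n i * cnj (x i)) - (\<Sum>i<M. Q n i * cnj (x i))))\<^sup>2)
     \<le> (\<Sum>i. (norm (x i))\<^sup>2) - (\<Sum>i<M. (norm (x i))\<^sup>2)"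
proof (rule LIMSEQ_le)
  show "(\<lambda>L. \<Sum>n<K. (norm ((\<Sum>i<L. Q n i * cnj (x i)) - (\<Sum>i<M. Q n i * cnj (x i))))\<^sup>2)
     \<longlonglongrightarrow> (\<Sum>n<K. (norm ((\<Sum>i. Q n i * cnj (x i)) - (\<Sum>i<M. Q n i * cnj (x i))))\<^sup>2)"
    using rows_sums[OF x] unfolding sums_def by (intro tendsto_intros) auto
  show "(\<lambda>L. (\<Sum>i<L. (norm (x i))\<^sup>2) - (\<Sum>i<M. (norm (x i))\<^sup>2))
     \<longlonglongrightarrow> (\<Sum>i. (norm (x i))\<^sup>2) - (\<Sum>i<M. (norm (x i))\<^sup>2)"
    by (intro tendsto_intros summable_LIMSEQ x)
  \<comment> \<open>Kept polymorphic because it rewrites both the complex pairings and the real sums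
    of squares.\<close>
  have split: "sum f {..<L} - sum f {..<M} = sum f {M..<L}" if "L \<ge> M"
    for L and f :: "nat \<Rightarrow> 'b::ab_group_add"
    using that sum_diff_nat_ivl[of 0 M L f] by (simp add: lessThan_atLeast0)
  show "\<exists>N. \<forall>L\<ge>N. (\<Sum>n<K. (norm ((\<Sum>i<L. Q n i * cnj (x i)) - (\<Sum>i<M. Q n i * cnj (x i))))\<^sup>2)
     \<le> (\<Sum>i<L. (norm (x i))\<^sup>2) - (\<Sum>i<M. (norm (x i))\<^sup>2)"
    by (intro exI[of _ M] allI impI) (simp only: split finite_bessel finite_atLeastLessThan)
qed

text \<open>Pairing with the rows of \<open>Q\<close> preserves inner products, and here every
  product of coefficients vanishes. Instead of extending \<open>finite_parseval\<close> to infinite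
  vectors, both vectors are truncated at \<open>M\<close>; the truncated inner product is then
  bounded by the tails \<open>tX M\<close> and \<open>tY M\<close>, which tend to 0.\<close>

lemma orthogonal_of_disjoint_spectra:
  assumes x: "summable (\<lambda>i. (norm (x i))\<^sup>2)" and y: "summable (\<lambda>i. (norm (y i))\<^sup>2)"
    and disj: "\<And>n. (\<Sum>i. Q n i * cnj (x i)) = 0 \<or> (\<Sum>i. Q n i * cnj (y i)) = 0"
  shows "(\<Sum>i. cnj (x i) * y i) = 0"
proof -
  define X Y where "X = (\<Sum>i. (norm (x i))\<^sup>2)" and "Y = (\<Sum>i. (norm (y i))\<^sup>2)"
  define tX tY where "tX = (\<lambda>M. X - (\<Sum>i<M. (norm (x i))\<^sup>2))"
    and "tY = (\<lambda>M. Y - (\<Sum>i<M. (norm (y i))\<^sup>2))"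
  have bound: "norm (\<Sum>i<M. cnj (x i) * y i) \<le> sqrt X * sqrt (tY M) + sqrt (tX M) * sqrt Y" for M
  proof -
    define Ax Ay Bx By where "Ax = (\<lambda>n. \<Sum>i<M. Q n i * cnj (x i))" and "Ay = (\<lambda>n. \<Sum>i<M. Q n i * cnj (y i))"
      and "Bx = (\<lambda>n. (\<Sum>i. Q n i * cnj (x i)) - Ax n)" and "By = (\<lambda>n. (\<Sum>i. Q n i * cnj (y i)) - Ay n)"
    have "norm (\<Sum>n<K. Ax n * cnj (Ay n)) \<le> sqrt X * sqrt (tY M) + sqrt (tX M) * sqrt Y" for K
    proof -
      have "norm (Ax n * cnj (Ay n)) \<le> norm (Ax n) * norm (By n) + norm (Bx n) * norm (Ay n)" for n
      proof -
        \<comment> \<open>The full coefficients are \<open>Ax n + Bx n\<close> and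
          \<open>Ay n + By n\<close>. If one of them vanishes, its truncated part is minus its
          remainder, so a factor of the product may be replaced by a small one.\<close>
        have "norm (Bx n) = norm (Ax n) \<or> norm (By n) = norm (Ay n)"
          using disj[of n] by (auto simp: Bx_def By_def)
        then show ?thesis by (auto simp: norm_mult)
      qed
      then have "norm (\<Sum>n<K. Ax n * cnj (Ay n))
          \<le> (\<Sum>n<K. norm (Ax n) * norm (By n) + norm (Bx n) * norm (Ay n))"
        by (intro sum_norm_le) auto
      also have "\<dots> \<le> sqrt X * sqrt (tY M) + sqrt (tX M) * sqrt Y"
      proof (unfold sum.distrib, intro add_mono sum_mult_le_L2)
        show "(\<Sum>n<K. (norm (Ax n))\<^sup>2) \<le> X"
          unfolding Ax_def X_def
          by (rule order_trans[OF finite_bessel]) (auto intro: sum_le_suminf x)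
        show "(\<Sum>n<K. (norm (Ay n))\<^sup>2) \<le> Y"
          unfolding Ay_def Y_def
          by (rule order_trans[OF finite_bessel]) (auto intro: sum_le_suminf y)
        show "(\<Sum>n<K. (norm (Bx n))\<^sup>2) \<le> tX M"
          unfolding Bx_def Ax_def tX_def X_def by (rule bessel_tail[OF x])
        show "(\<Sum>n<K. (norm (By n))\<^sup>2) \<le> tY M"
          unfolding By_def Ay_def tY_def Y_def by (rule bessel_tail[OF y])
      qed auto
      finally show ?thesis .
    qed
    moreover have "(\<lambda>n. Ax n * cnj (Ay n)) sums (\<Sum>i<M. cnj (x i) * y i)"
      unfolding Ax_def Ay_def by (rule finite_parseval) simp
    ultimately show ?thesis
      unfolding sums_def by (intro LIMSEQ_le_const2[OF tendsto_norm]) auto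
  qed
  have "tX \<longlonglongrightarrow> X - X" "tY \<longlonglongrightarrow> Y - Y"
    unfolding tX_def tY_def X_def Y_def by (intro tendsto_intros summable_LIMSEQ x y)+
  then have "(\<lambda>M. sqrt X * sqrt (tY M) + sqrt (tX M) * sqrt Y) \<longlonglongrightarrow> sqrt X * sqrt (Y - Y) + sqrt (X - X) * sqrt Y"
    by (intro tendsto_intros)
  then have "(\<lambda>M. sqrt X * sqrt (tY M) + sqrt (tX M) * sqrt Y) \<longlonglongrightarrow> 0"
    by simp
  then have "(\<lambda>M. \<Sum>i<M. cnj (x i) * y i) \<longlonglongrightarrow> 0"
    by (rule Lim_null_comparison[rotated]) (use bound in \<open>simp add: always_eventually\<close>)
  then show ?thesis
    by (simp add: sums_def[symmetric] sums_iff)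
qed

end

section \<open>Taylor coefficients\<close>

lemma taylor_coeff_cong:
  assumes "f holomorphic_on ball 0 r" "0 < r" "\<And>z. z \<in> ball 0 r \<Longrightarrow> f z = g z"
  shows "taylor_coeff f i = taylor_coeff g i"
proof -
  have "g holomorphic_on ball 0 r"
    using assms holomorphic_cong by blast
  then show ?thesis
    using higher_deriv_transform_within_open[OF assms(1) _ _ _ assms(3), where i = i and z = 0] assms(2)
    by (simp add: taylor_coeff_def)
qed

lemma taylor_coeff_cmult:
  assumes "f holomorphic_on ball 0 r" "0 < r"
  shows "taylor_coeff (\<lambda>z. c * f z) i = c * taylor_coeff f i"
  using higher_deriv_cmult[OF assms(1), of 0] assms(2) by (simp add: taylor_coeff_def)

lemma taylor_coeff_sum:
  assumes "\<And>k. k \<in> I \<Longrightarrow> f k holomorphic_on ball 0 r" "0 < r"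
  shows "taylor_coeff (\<lambda>z. \<Sum>k\<in>I. f k z) i = (\<Sum>k\<in>I. taylor_coeff (f k) i)"
  using assms(1)
proof (induction I rule: infinite_finite_induct)
  case (insert k I)
  have "taylor_coeff (\<lambda>z. f k z + (\<Sum>k\<in>I. f k z)) i = taylor_coeff (f k) i + taylor_coeff (\<lambda>z. \<Sum>k\<in>I. f k z) i"
    using higher_deriv_add[of "f k" "ball 0 r" "\<lambda>z. \<Sum>k\<in>I. f k z" 0] insert.prems assms(2)
    by (simp add: taylor_coeff_def holomorphic_on_sum add_divide_distrib)
  then show ?case using insert by simp
qed (auto simp: taylor_coeff_def)

lemma taylor_coeff_powser:
  assumes r: "0 < r" and f: "\<And>z. z \<in> ball 0 r \<Longrightarrow> (\<lambda>n. a n * z ^ n) sums f z"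
  shows "taylor_coeff f i = a i"
proof -
  have "f has_fps_expansion Abs_fps a"
    unfolding has_fps_expansion_def
  proof
    have "conv_radius a \<ge> norm (of_real (r/2) :: complex)"
      by (rule conv_radius_geI) (use f[of "of_real (r/2)"] r in \<open>auto simp: sums_iff\<close>)
    then show "fps_conv_radius (Abs_fps a) > 0"
      using r by (auto simp: fps_conv_radius_def intro: less_le_trans[rotated])
    have "eventually (\<lambda>z::complex. z \<in> ball 0 r) (nhds 0)"
      using r by (intro eventually_nhds_in_open) auto
    then show "\<forall>\<^sub>F z in nhds 0. eval_fps (Abs_fps a) z = f z"
      by eventually_elim (use f in \<open>auto simp: eval_fps_def sums_iff\<close>)
  qed
  from fps_nth_fps_expansion[OF this, of i] show ?thesis
    by (simp add: taylor_coeff_def)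
qed

text \<open>The Weierstrass M-test gives uniform convergence of the partial sums, and derivatives at
  0 of holomorphic functions pass to uniform limits.\<close>

lemma taylor_coeff_suminf:
  assumes "0 < r" and hol: "\<And>n. f n holomorphic_on ball 0 r"
    and bd: "\<And>n z. z \<in> ball 0 r \<Longrightarrow> norm (f n z) \<le> M n" and "summable M"
    and sums: "\<And>z. z \<in> ball 0 r \<Longrightarrow> (\<lambda>n. f n z) sums g z"
  shows "(\<lambda>n. taylor_coeff (f n) i) sums taylor_coeff g i"
proof -
  have "uniform_limit (ball 0 r) (\<lambda>n z. \<Sum>k<n. f k z) (\<lambda>z. \<Sum>k. f k z) sequentially"
    by (rule Weierstrass_m_test) (use bd \<open>summable M\<close> in auto)
  moreover have "(\<Sum>k. f k z) = g z" if "z \<in> ball 0 r" for z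
    using sums[OF that] by (simp add: sums_iff)
  ultimately have "uniform_limit (ball 0 r) (\<lambda>n z. \<Sum>k<n. f k z) g sequentially"
    by (metis (mono_tags, lifting) uniform_limit_cong')
  then have "(\<lambda>n. (deriv ^^ i) (\<lambda>z. \<Sum>k<n. f k z) 0) \<longlonglongrightarrow> (deriv ^^ i) g 0"
    by (rule higher_deriv_complex_uniform_limit)
      (use \<open>0 < r\<close> hol in \<open>auto intro!: holomorphic_on_sum always_eventually\<close>)
  then have "(\<lambda>n. taylor_coeff (\<lambda>z. \<Sum>k<n. f k z) i) \<longlonglongrightarrow> taylor_coeff g i"
    unfolding taylor_coeff_def by (intro tendsto_intros) auto
  then show ?thesis
    using taylor_coeff_sum[where f = f, OF hol \<open>0 < r\<close>] by (simp add: sums_def)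
qed

text \<open>Cauchy's estimate on the circle of radius \<open>r/2\<close>, which stays inside the
  open disc where \<open>f\<close> is controlled.\<close>

lemma taylor_coeff_bound:
  assumes "f holomorphic_on ball 0 r" "0 < r" "\<And>z. z \<in> ball 0 r \<Longrightarrow> norm (f z) \<le> B"
  shows "norm (taylor_coeff f i) \<le> B / (r/2) ^ i"
proof -
  have "norm ((deriv ^^ i) f 0) \<le> fact i * B / (r/2) ^ i"
  proof (rule Cauchy_inequality)
    show "f holomorphic_on ball 0 (r/2)"
      using assms by (auto intro: holomorphic_on_subset)
    show "continuous_on (cball 0 (r/2)) f"
      using assms by (intro holomorphic_on_imp_continuous_on holomorphic_on_subset[OF assms(1)]) auto
  qed (use assms in auto)
  then show ?thesis
    by (simp add: taylor_coeff_def norm_divide pos_divide_le_eq mult_ac)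
qed

text \<open>Two expansions of one kernel \<open>G z w\<close> are compared coefficientwise: first
  the coefficient of \<open>z ^ j\<close> is extracted with \<open>w\<close> fixed, then the
  identity is conjugated to become holomorphic in \<open>w\<close>, and the coefficient of
  \<open>w ^ i\<close> is extracted. Each extraction needs a summable majorant; in the second one
  \<open>taylor_coeff_bound\<close> supplies it.\<close>

lemma taylor_coeff_kernel:
  fixes c h :: "nat \<Rightarrow> real"
  assumes "0 < r" and hol: "\<And>n. f n holomorphic_on ball 0 r"
    and bd: "\<And>n z. z \<in> ball 0 r \<Longrightarrow> norm (f n z) \<le> B n"
    and c: "\<And>n. 0 \<le> c n" and "summable (\<lambda>n. c n * (B n)\<^sup>2)"
    and G1: "\<And>z w. z \<in> ball 0 r \<Longrightarrow> w \<in> ball 0 r \<Longrightarrow> (\<lambda>n. of_real (c n) * f n z * cnj (f n w)) sums G z w"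
    and G2: "\<And>z w. z \<in> ball 0 r \<Longrightarrow> w \<in> ball 0 r \<Longrightarrow> (\<lambda>i. of_real (h i) * (z * cnj w) ^ i) sums G z w"
  shows "(\<lambda>n. of_real (c n) * taylor_coeff (f n) i * cnj (taylor_coeff (f n) j))
     sums (if i = j then of_real (h i) else 0)"
proof -
  have B: "0 \<le> B n" for n
    using bd[of 0 n] \<open>0 < r\<close> by (metis centre_in_ball norm_ge_zero order_trans)
  have 1: "(\<lambda>n. of_real (c n) * cnj (taylor_coeff (f n) j) * f n w) sums (of_real (h j) * w ^ j)"
    if w: "w \<in> ball 0 r" for w
  proof -
    have "(\<lambda>n. taylor_coeff (\<lambda>z. of_real (c n) * cnj (f n w) * f n z) j) sums taylor_coeff (\<lambda>z. G z w) j"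
    proof (rule taylor_coeff_suminf[OF \<open>0 < r\<close>])
      fix n z assume "z \<in> ball (0::complex) r"
      then show "norm (of_real (c n) * cnj (f n w) * f n z) \<le> c n * (B n)\<^sup>2"
        using bd[OF w, of n] bd[of z n] B[of n] c[of n]
        by (simp add: norm_mult power2_eq_square mult.assoc mult_left_mono mult_mono)
    qed (use hol w G1 \<open>summable _\<close> in \<open>auto intro!: holomorphic_intros simp: mult_ac\<close>)
    also have "taylor_coeff (\<lambda>z. G z w) j = of_real (h j) * cnj w ^ j"
      by (rule taylor_coeff_powser[OF \<open>0 < r\<close>]) (use G2[OF _ w] in \<open>simp add: power_mult_distrib mult_ac\<close>)
    finally have "(\<lambda>n. of_real (c n) * cnj (f n w) * taylor_coeff (f n) j) sums (of_real (h j) * cnj w ^ j)"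
      using taylor_coeff_cmult[OF hol \<open>0 < r\<close>] by simp
    then show ?thesis
      by (subst sums_cnj[symmetric]) (simp add: mult_ac)
  qed
  have "(\<lambda>n. taylor_coeff (\<lambda>z. of_real (c n) * cnj (taylor_coeff (f n) j) * f n z) i)
      sums taylor_coeff (\<lambda>z. of_real (h j) * z ^ j) i"
  proof (rule taylor_coeff_suminf[OF \<open>0 < r\<close>])
    show "summable (\<lambda>n. c n * (B n)\<^sup>2 / (r/2)^j)"
      using \<open>summable _\<close> by (rule summable_divide)
    fix n z assume z: "z \<in> ball (0::complex) r"
    have "norm (of_real (c n) * cnj (taylor_coeff (f n) j) * f n z) \<le> c n * (B n / (r/2)^j * B n)"
      using bd[OF z, of n] taylor_coeff_bound[OF hol \<open>0 < r\<close> bd, of n j] B[of n] c[of n] \<open>0 < r\<close>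
      unfolding norm_mult mult.assoc by (intro mult_mono) (auto intro!: mult_nonneg_nonneg)
    then show "norm (of_real (c n) * cnj (taylor_coeff (f n) j) * f n z) \<le> c n * (B n)\<^sup>2 / (r/2)^j"
      by (simp add: power2_eq_square)
  qed (use hol 1 in \<open>auto intro!: holomorphic_intros\<close>)
  also have "taylor_coeff (\<lambda>z. of_real (h j) * z ^ j) i = (if i = j then of_real (h i) else 0)"
  proof (rule taylor_coeff_powser[OF \<open>0 < r\<close>])
    fix z :: complex
    have "(\<lambda>n. if n = j then of_real (h n) * z ^ n else 0) sums (of_real (h j) * z ^ j)"
      by (rule sums_single)
    then show "(\<lambda>n. (if n = j then of_real (h n) else 0) * z ^ n) sums (of_real (h j) * z ^ j)"
      by (simp add: if_distrib[of "\<lambda>x. x * _"] cong: if_cong)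
  qed
  finally show ?thesis
    unfolding taylor_coeff_cmult[OF hol \<open>0 < r\<close>] by (simp only: mult_ac)
qed

section \<open>The weighted Bergman space\<close>

text \<open>For natural \<open>\<beta>\<close> both Gamma values are factorials.\<close>

lemma bergman_weight_of_nat:
  "bergman_weight (real \<beta>) n = 1 / real ((n + \<beta> + 1) choose n)"
proof -
  have "Gamma (2 + real \<beta>) = fact (\<beta> + 1)" "Gamma (real n + 2 + real \<beta>) = fact (n + \<beta> + 1)"
    using Gamma_fact[of "\<beta> + 1", where 'a = real] Gamma_fact[of "n + \<beta> + 1", where 'a = real]
    by (simp_all add: algebra_simps)
  then show ?thesis
    by (simp add: bergman_weight_def binomial_fact algebra_simps)
qed

lemma bergman_weight_pos: "0 < bergman_weight (real \<beta>) n"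
  unfolding bergman_weight_of_nat by (simp add: zero_less_binomial)

lemma bergman_weight_le_1: "bergman_weight (real \<beta>) n \<le> 1"
proof -
  have "0 < (n + \<beta> + 1) choose n" by (rule zero_less_binomial) simp
  then have "1 \<le> real ((n + \<beta> + 1) choose n)" by linarith
  then show ?thesis by (simp only: bergman_weight_of_nat divide_le_eq_1_pos)
qed

text \<open>This is the reproducing kernel of the space at \<open>x = z * cnj w\<close>, obtained
  from the binomial series with exponent \<open>- (\<beta> + 2)\<close>.\<close>

lemma bergman_kernel_sums:
  fixes x :: complex
  assumes "norm x < 1"
  shows "(\<lambda>n. of_real (1 / bergman_weight (real \<beta>) n) * x ^ n) sums (1 / (1 - x) ^ (\<beta> + 2))"
proof -
  have "1 - x \<noteq> 0" using assms by auto
  then have "(1 + - x) powr (- of_nat (\<beta> + 2)) = 1 / (1 - x) ^ (\<beta> + 2)"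
    by (subst powr_minus, subst powr_nat') (auto simp: divide_inverse)
  moreover have "(- 1) ^ n * ((of_nat (\<beta> + 2) + of_nat n - 1) gchoose n) * (- x) ^ n
      = of_real (1 / bergman_weight (real \<beta>) n) * x ^ n" for n
  proof -
    have "(of_nat (\<beta> + 2) + of_nat n - 1 :: complex) = of_nat (n + \<beta> + 1)"
      by simp
    then have "((of_nat (\<beta> + 2) + of_nat n - 1 :: complex) gchoose n) = of_nat ((n + \<beta> + 1) choose n)"
      by (simp only: binomial_gbinomial)
    moreover have "(- 1) ^ n * (- x) ^ n = x ^ n"
      by (simp flip: power_mult_distrib)
    ultimately show ?thesis
      by (simp add: bergman_weight_of_nat mult_ac)
  qed
  ultimately show ?thesis
    using one_plus_neg_powr_powser[of "- x" "of_nat (\<beta> + 2)"] assms by simp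
qed

text \<open>Convergence of the power series at a point \<open>\<rho>\<close> with
  \<open>1 < \<rho> < R\<close> makes the coefficients absolutely summable. They are eventually
  below 1 in norm and the weights are at most 1, so the weighted squares are eventually dominated by
  the norms themselves.\<close>

lemma A2_of_holomorphic_on_larger_disc:
  assumes f: "f holomorphic_on ball 0 R" and "1 < R"
  shows "f \<in> A2 (real \<beta>)"
proof -
  obtain \<rho> where \<rho>: "1 < \<rho>" "\<rho> < R" using \<open>1 < R\<close> dense by blast
  have "(\<lambda>n. (deriv ^^ n) f 0 / fact n * (of_real \<rho> - 0) ^ n) sums f (of_real \<rho>)"
    by (rule holomorphic_power_series[OF f]) (use \<rho> in auto)
  then have "summable (\<lambda>n. taylor_coeff f n * of_real \<rho> ^ n)"
    by (simp add: taylor_coeff_def sums_iff)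
  from powser_insidea[OF this, of 1] have *: "summable (\<lambda>n. norm (taylor_coeff f n))"
    using \<rho> by simp
  have "eventually (\<lambda>n. norm (taylor_coeff f n) < 1) sequentially"
    using summable_LIMSEQ_zero[OF *] by (rule order_tendstoD) simp
  then have "eventually (\<lambda>n. norm (bergman_weight (real \<beta>) n * (norm (taylor_coeff f n))\<^sup>2)
      \<le> norm (taylor_coeff f n)) sequentially"
  proof eventually_elim
    case (elim n)
    have "bergman_weight (real \<beta>) n * (norm (taylor_coeff f n))\<^sup>2 \<le> 1 * norm (taylor_coeff f n)"
      unfolding power2_eq_square using elim bergman_weight_le_1[of \<beta> n]
      by (intro mult_mono mult_left_le) auto
    then show ?case
      using bergman_weight_pos[of \<beta> n] by (simp add: abs_mult)
  qed
  then have "summable (\<lambda>n. bergman_weight (real \<beta>) n * (norm (taylor_coeff f n))\<^sup>2)"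
    by (rule summable_comparison_test_ev) (rule *)
  then show ?thesis
    using holomorphic_on_subset[OF f, of unit_disc] \<open>1 < R\<close> by (simp add: A2_def subset_ball)
qed

lemma A2_holomorphic: "f \<in> A2 \<beta> \<Longrightarrow> f holomorphic_on unit_disc"
  by (simp add: A2_def)

lemma taylor_coeff_eq_disc:
  assumes "f holomorphic_on unit_disc" "eq_disc f g"
  shows "taylor_coeff f = taylor_coeff g"
  using taylor_coeff_cong[OF assms(1)] assms(2) by (auto simp: eq_disc_def)

lemma A2_eq_disc:
  assumes "f \<in> A2 \<beta>" "eq_disc f g"
  shows "g \<in> A2 \<beta>"
  using assms taylor_coeff_eq_disc[OF A2_holomorphic[OF assms(1)] assms(2)]
    holomorphic_cong[of unit_disc unit_disc f g]
  by (simp add: A2_def eq_disc_def)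

lemma A2_inner_eq_disc_left:
  assumes "f holomorphic_on unit_disc" "eq_disc f g"
  shows "A2_inner \<beta> f h = A2_inner \<beta> g h"
  using taylor_coeff_eq_disc[OF assms] by (simp add: A2_inner_def)

lemma A2_inner_eq_disc_right:
  assumes "f holomorphic_on unit_disc" "eq_disc f g"
  shows "A2_inner \<beta> h f = A2_inner \<beta> h g"
  using taylor_coeff_eq_disc[OF assms] by (simp add: A2_inner_def)

lemma A2_square_summable:
  assumes "f \<in> A2 (real \<beta>)"
  shows "summable (\<lambda>n. (norm (of_real (sqrt (bergman_weight (real \<beta>) n)) * taylor_coeff f n))\<^sup>2)"
proof -
  have "(norm (of_real (sqrt (bergman_weight (real \<beta>) n)) * taylor_coeff f n))\<^sup>2
      = bergman_weight (real \<beta>) n * (norm (taylor_coeff f n))\<^sup>2" for n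
    using bergman_weight_pos[of \<beta> n] by (simp add: norm_mult power_mult_distrib)
  then show ?thesis
    using assms by (simp add: A2_def)
qed

lemma A2_inner_summable:
  assumes "f \<in> A2 (real \<beta>)" "g \<in> A2 (real \<beta>)"
  shows "summable (\<lambda>n. of_real (bergman_weight (real \<beta>) n) * taylor_coeff f n * cnj (taylor_coeff g n))"
proof -
  have "summable (\<lambda>n. of_real (sqrt (bergman_weight (real \<beta>) n)) * taylor_coeff f n
      * cnj (of_real (sqrt (bergman_weight (real \<beta>) n)) * taylor_coeff g n))"
    using A2_square_summable[OF assms(1)] A2_square_summable[OF assms(2)]
    by (intro summable_mult_of_square_summable) (simp_all only: complex_mod_cnj)
  moreover have "of_real (sqrt (bergman_weight (real \<beta>) n)) * taylor_coeff f n
      * cnj (of_real (sqrt (bergman_weight (real \<beta>) n)) * taylor_coeff g n)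
      = of_real (bergman_weight (real \<beta>) n) * taylor_coeff f n * cnj (taylor_coeff g n)" for n
  proof -
    have "complex_of_real (sqrt (bergman_weight (real \<beta>) n)) * of_real (sqrt (bergman_weight (real \<beta>) n))
        = of_real (bergman_weight (real \<beta>) n)"
      using bergman_weight_pos[of \<beta> n] by (simp flip: of_real_mult)
    from this[symmetric] show ?thesis
      by (simp only: complex_cnj_mult complex_cnj_complex_of_real mult_ac)
  qed
  ultimately show ?thesis by (simp only:)
qed

lemma A2_inner_cmult_left:
  assumes "f \<in> A2 (real \<beta>)" "g \<in> A2 (real \<beta>)"
  shows "A2_inner (real \<beta>) (\<lambda>z. c * f z) g = c * A2_inner (real \<beta>) f g"
  unfolding A2_inner_def suminf_mult[OF A2_inner_summable[OF assms], symmetric]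
    taylor_coeff_cmult[OF A2_holomorphic[OF assms(1)] zero_less_one]
  by (simp add: mult_ac)

lemma A2_inner_cmult_right:
  assumes "f \<in> A2 (real \<beta>)" "g \<in> A2 (real \<beta>)"
  shows "A2_inner (real \<beta>) f (\<lambda>z. c * g z) = cnj c * A2_inner (real \<beta>) f g"
  unfolding A2_inner_def suminf_mult[OF A2_inner_summable[OF assms], symmetric]
    taylor_coeff_cmult[OF A2_holomorphic[OF assms(2)] zero_less_one]
  by (simp add: mult_ac)

lemma A2_inner_sum_left:
  assumes "\<And>k. k \<in> I \<Longrightarrow> f k \<in> A2 (real \<beta>)" "g \<in> A2 (real \<beta>)"
  shows "A2_inner (real \<beta>) (\<lambda>z. \<Sum>k\<in>I. c k * f k z) g = (\<Sum>k\<in>I. c k * A2_inner (real \<beta>) (f k) g)"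
proof -
  have "taylor_coeff (\<lambda>z. \<Sum>k\<in>I. c k * f k z) n = (\<Sum>k\<in>I. c k * taylor_coeff (f k) n)" for n
  proof -
    have "taylor_coeff (\<lambda>z. \<Sum>k\<in>I. c k * f k z) n = (\<Sum>k\<in>I. taylor_coeff (\<lambda>z. c k * f k z) n)"
      using assms(1) A2_holomorphic
      by (intro taylor_coeff_sum[OF _ zero_less_one] holomorphic_intros) blast
    also have "\<dots> = (\<Sum>k\<in>I. c k * taylor_coeff (f k) n)"
      using assms(1) by (intro sum.cong refl taylor_coeff_cmult[OF A2_holomorphic zero_less_one])
    finally show ?thesis .
  qed
  then have "A2_inner (real \<beta>) (\<lambda>z. \<Sum>k\<in>I. c k * f k z) g = (\<Sum>n. \<Sum>k\<in>I. c k *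
      (of_real (bergman_weight (real \<beta>) n) * taylor_coeff (f k) n * cnj (taylor_coeff g n)))"
    unfolding A2_inner_def by (simp add: sum_distrib_left sum_distrib_right mult_ac)
  also have "\<dots> = (\<Sum>k\<in>I. \<Sum>n. c k *
      (of_real (bergman_weight (real \<beta>) n) * taylor_coeff (f k) n * cnj (taylor_coeff g n)))"
    by (intro suminf_sum summable_mult A2_inner_summable assms)
  also have "\<dots> = (\<Sum>k\<in>I. c k * A2_inner (real \<beta>) (f k) g)"
    unfolding A2_inner_def using assms by (intro sum.cong refl suminf_mult A2_inner_summable)
  finally show ?thesis .
qed

text \<open>The inner product of \<open>T f\<close> with \<open>u\<close> equals both
  \<open>a\<close> and \<open>cnj b\<close> times that of \<open>f\<close> with \<open>u\<close>.
  The hypothesis on \<open>T f\<close> has the multiple of \<open>f\<close> on the left because that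
  side is the one known to be holomorphic.\<close>

lemma adjoint_eigenvector_orthogonal:
  assumes "is_adjoint (real \<beta>) T S" and f: "f \<in> A2 (real \<beta>)" and u: "u \<in> A2 (real \<beta>)"
    and Tf: "eq_disc (\<lambda>z. a * f z) (T f)" and Su: "eq_disc (S u) (\<lambda>z. b * u z)"
    and "a \<noteq> cnj b"
  shows "A2_inner (real \<beta>) f u = 0"
proof -
  have "a * A2_inner (real \<beta>) f u = A2_inner (real \<beta>) (T f) u"
    unfolding A2_inner_cmult_left[OF f u, symmetric]
    by (intro A2_inner_eq_disc_left[OF _ Tf] holomorphic_intros A2_holomorphic[OF f])
  also have "\<dots> = A2_inner (real \<beta>) f (S u)"
    using assms by (simp add: is_adjoint_def)
  also have "\<dots> = cnj b * A2_inner (real \<beta>) f u"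
    unfolding A2_inner_cmult_right[OF f u, symmetric] using assms(1) u
    by (intro A2_inner_eq_disc_right[OF _ Su] A2_holomorphic[of _ "real \<beta>"]) (simp add: is_adjoint_def)
  finally show ?thesis
    using \<open>a \<noteq> cnj b\<close> by simp
qed

section \<open>Disc automorphisms\<close>

text \<open>Bounding only the product of the norms lets \<open>z\<close> leave the unit disc, up to
  the circle of radius \<open>1 / norm \<alpha>\<close> carrying the pole of
  \<open>phi_aut \<alpha>\<close>.\<close>

lemma phi_aut_denom_nonzero:
  fixes \<alpha> z :: complex
  assumes "norm \<alpha> * norm z < 1"
  shows "1 - cnj \<alpha> * z \<noteq> 0"
proof
  assume "1 - cnj \<alpha> * z = 0"
  then have "norm (cnj \<alpha> * z) = 1" by simp
  then show False using assms by (simp add: norm_mult)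
qed

lemma norm_mult_less_1:
  fixes a b :: complex
  assumes "norm a < 1" "norm b < 1"
  shows "norm a * norm b < 1"
  using mult_strict_mono'[OF assms] by simp

lemma of_real_norm_compl: "complex_of_real (1 - (norm a)\<^sup>2) = 1 - a * cnj a"
  by (simp only: of_real_diff of_real_1 complex_norm_square)

lemma one_minus_phi_aut:
  assumes "norm \<alpha> < 1" "norm z < 1"
  shows "1 - cnj \<alpha> * phi_aut \<alpha> z = of_real (1 - (norm \<alpha>)\<^sup>2) / (1 - cnj \<alpha> * z)"
  unfolding of_real_norm_compl phi_aut_def
  using phi_aut_denom_nonzero[OF norm_mult_less_1[OF assms]] by (simp add: field_simps)

text \<open>The polarised Schwarz-Pick identity. It transforms the Bergman kernel under
  \<open>phi_aut \<alpha>\<close>, and its diagonal case shows that the disc is mapped into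
  itself.\<close>

lemma one_minus_phi_aut_mult_cnj:
  assumes "norm \<alpha> < 1" "norm z < 1" "norm w < 1"
  shows "1 - phi_aut \<alpha> z * cnj (phi_aut \<alpha> w)
    = of_real (1 - (norm \<alpha>)\<^sup>2) * (1 - z * cnj w) / ((1 - cnj \<alpha> * z) * (1 - \<alpha> * cnj w))"
proof -
  have "1 - cnj \<alpha> * z \<noteq> 0" "1 - \<alpha> * cnj w \<noteq> 0"
    using phi_aut_denom_nonzero[of \<alpha> z] phi_aut_denom_nonzero[of "cnj \<alpha>" "cnj w"]
      norm_mult_less_1 assms by auto
  then have "1 - phi_aut \<alpha> z * cnj (phi_aut \<alpha> w)
      = ((1 - cnj \<alpha> * z) * (1 - \<alpha> * cnj w) - (\<alpha> - z) * (cnj \<alpha> - cnj w))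
        / ((1 - cnj \<alpha> * z) * (1 - \<alpha> * cnj w))"
    by (simp add: phi_aut_def diff_divide_distrib[of "(1 - cnj \<alpha> * z) * (1 - \<alpha> * cnj w)"])
  also have "(1 - cnj \<alpha> * z) * (1 - \<alpha> * cnj w) - (\<alpha> - z) * (cnj \<alpha> - cnj w)
      = (1 - \<alpha> * cnj \<alpha>) * (1 - z * cnj w)"
    by algebra
  finally show ?thesis
    unfolding of_real_norm_compl .
qed

lemma norm_phi_aut_less_1:
  assumes "norm \<alpha> < 1" "norm z < 1"
  shows "norm (phi_aut \<alpha> z) < 1"
proof -
  have sq: "(norm \<alpha>)\<^sup>2 < 1" "(norm z)\<^sup>2 < 1"
    using assms by (simp_all add: power_less_one_iff abs_square_less_1)
  have "complex_of_real (1 - (norm (phi_aut \<alpha> z))\<^sup>2)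
      = of_real (1 - (norm \<alpha>)\<^sup>2) * of_real (1 - (norm z)\<^sup>2) / ((1 - cnj \<alpha> * z) * cnj (1 - cnj \<alpha> * z))"
    unfolding of_real_norm_compl[of "phi_aut \<alpha> z"] of_real_norm_compl[of z]
      one_minus_phi_aut_mult_cnj[OF assms assms(2)] by simp
  also have "\<dots> = of_real ((1 - (norm \<alpha>)\<^sup>2) * (1 - (norm z)\<^sup>2) / (norm (1 - cnj \<alpha> * z))\<^sup>2)"
    by (simp only: complex_norm_square[symmetric] of_real_mult of_real_divide)
  finally have "1 - (norm (phi_aut \<alpha> z))\<^sup>2 = (1 - (norm \<alpha>)\<^sup>2) * (1 - (norm z)\<^sup>2) / (norm (1 - cnj \<alpha> * z))\<^sup>2"
    by (simp only: of_real_eq_iff)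
  also have "\<dots> > 0"
    using sq phi_aut_denom_nonzero[OF norm_mult_less_1[OF assms]] by simp
  finally show ?thesis
    by (simp add: abs_square_less_1)
qed

lemma phi_aut_involution:
  assumes "norm \<alpha> < 1" "norm z < 1"
  shows "phi_aut \<alpha> (phi_aut \<alpha> z) = z"
proof -
  have nz: "1 - cnj \<alpha> * z \<noteq> 0"
    by (rule phi_aut_denom_nonzero[OF norm_mult_less_1[OF assms]])
  have nz': "1 - \<alpha> * cnj \<alpha> \<noteq> 0"
    using phi_aut_denom_nonzero[OF norm_mult_less_1[OF assms(1) assms(1)]] by (simp add: mult.commute)
  have "phi_aut \<alpha> (phi_aut \<alpha> z) = (\<alpha> - phi_aut \<alpha> z) / ((1 - \<alpha> * cnj \<alpha>) / (1 - cnj \<alpha> * z))"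
    unfolding of_real_norm_compl[symmetric] one_minus_phi_aut[OF assms, symmetric]
    by (simp add: phi_aut_def[of \<alpha> "phi_aut \<alpha> z"])
  also have "\<alpha> - phi_aut \<alpha> z = z * (1 - \<alpha> * cnj \<alpha>) / (1 - cnj \<alpha> * z)"
    unfolding phi_aut_def using nz by (simp add: field_simps)
  finally show ?thesis
    using nz nz' by simp
qed

lemma phi_aut_holomorphic:
  assumes "\<alpha> \<noteq> 0"
  shows "phi_aut \<alpha> holomorphic_on ball 0 (1 / norm \<alpha>)"
proof -
  have "1 - cnj \<alpha> * z \<noteq> 0" if "z \<in> ball 0 (1 / norm \<alpha>)" for z
    by (rule phi_aut_denom_nonzero) (use that assms in \<open>simp add: field_simps\<close>)
  then show ?thesis
    unfolding phi_aut_def[abs_def] by (intro holomorphic_intros) auto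
qed

section \<open>The complete system attached to a disc automorphism\<close>

context
  fixes \<beta> :: nat and \<alpha> :: complex
  assumes \<alpha>: "norm \<alpha> < 1" "\<alpha> \<noteq> 0"
begin

lemma one_less_inverse_norm: "1 < 1 / norm \<alpha>"
  using \<alpha> by simp

lemma phi_aut_power_A2: "(\<lambda>z. phi_aut \<alpha> z ^ n) \<in> A2 (real \<beta>)"
  by (intro A2_of_holomorphic_on_larger_disc[OF _ one_less_inverse_norm] holomorphic_intros
      phi_aut_holomorphic \<alpha>)

text \<open>By \<open>one_minus_phi_aut\<close> the first factor is, on the disc, a constant
  multiple of \<open>1 / (1 - cnj \<alpha> * z) ^ (\<beta> + 2)\<close>, the weight that makes
  composition with \<open>phi_aut \<alpha>\<close> unitary up to scale. Written through
  \<open>phi_aut \<alpha>\<close> it is visibly a polynomial in that function.\<close>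

definition mobius_basis :: "nat \<Rightarrow> complex \<Rightarrow> complex" where
  "mobius_basis n z = (1 - cnj \<alpha> * phi_aut \<alpha> z) ^ (\<beta> + 2) * phi_aut \<alpha> z ^ n"

lemma mobius_basis_holomorphic: "mobius_basis n holomorphic_on ball 0 (1 / norm \<alpha>)"
  unfolding mobius_basis_def[abs_def]
  by (intro holomorphic_intros phi_aut_holomorphic \<alpha>)

lemma mobius_basis_A2: "mobius_basis n \<in> A2 (real \<beta>)"
  using mobius_basis_holomorphic one_less_inverse_norm by (rule A2_of_holomorphic_on_larger_disc)

text \<open>As \<open>\<beta>\<close> is natural, the binomial expansion stops: only
  \<open>\<beta> + 3\<close> consecutive powers of \<open>phi_aut \<alpha>\<close> occur.\<close>

lemma mobius_basis_expand:
  "mobius_basis n = (\<lambda>z. \<Sum>k\<le>\<beta>+2. (of_nat ((\<beta> + 2) choose k) * (- cnj \<alpha>) ^ k) * phi_aut \<alpha> z ^ (n + k))"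
proof
  fix z
  have "(- cnj \<alpha> * phi_aut \<alpha> z + 1) ^ (\<beta> + 2)
      = (\<Sum>k\<le>\<beta>+2. of_nat ((\<beta> + 2) choose k) * (- cnj \<alpha> * phi_aut \<alpha> z) ^ k * 1 ^ (\<beta> + 2 - k))"
    by (rule binomial_ring)
  moreover have "1 - cnj \<alpha> * phi_aut \<alpha> z = - cnj \<alpha> * phi_aut \<alpha> z + 1"
    by simp
  ultimately have "mobius_basis n z
      = (\<Sum>k\<le>\<beta>+2. of_nat ((\<beta> + 2) choose k) * (- cnj \<alpha> * phi_aut \<alpha> z) ^ k * 1 ^ (\<beta> + 2 - k)) * phi_aut \<alpha> z ^ n"
    unfolding mobius_basis_def by (simp only:)
  then show "mobius_basis n z
      = (\<Sum>k\<le>\<beta>+2. (of_nat ((\<beta> + 2) choose k) * (- cnj \<alpha>) ^ k) * phi_aut \<alpha> z ^ (n + k))"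
    unfolding sum_distrib_right
    by (simp only: power_mult_distrib power_add power_one mult_1_left mult_1_right mult_ac)
qed

text \<open>The kernel series is evaluated at the images of \<open>z\<close> and \<open>w\<close>
  and multiplied by the two weights; the Schwarz-Pick identity turns the result into a constant
  multiple of the kernel at \<open>z\<close> and \<open>w\<close>.\<close>

lemma mobius_basis_kernel:
  assumes z: "norm z < 1" and w: "norm w < 1"
  shows "(\<lambda>n. of_real (1 / bergman_weight (real \<beta>) n) * mobius_basis n z * cnj (mobius_basis n w))
    sums (of_real ((1 - (norm \<alpha>)\<^sup>2) ^ (\<beta> + 2)) / (1 - z * cnj w) ^ (\<beta> + 2))"
proof -
  let ?p = "phi_aut \<alpha>" and ?s = "complex_of_real (1 - (norm \<alpha>)\<^sup>2)"
  define A where "A = 1 - cnj \<alpha> * z"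
  define B where "B = 1 - \<alpha> * cnj w"
  have nz: "A \<noteq> 0" "B \<noteq> 0" "1 - z * cnj w \<noteq> 0" "?s \<noteq> 0"
    using phi_aut_denom_nonzero[of \<alpha> z] phi_aut_denom_nonzero[of "cnj \<alpha>" "cnj w"]
      phi_aut_denom_nonzero[of w z] phi_aut_denom_nonzero[of \<alpha> \<alpha>]
      norm_mult_less_1 \<alpha>(1) z w unfolding of_real_norm_compl A_def B_def by (auto simp: mult.commute)
  have A: "1 - cnj \<alpha> * ?p z = ?s / A"
    unfolding A_def by (rule one_minus_phi_aut[OF \<alpha>(1) z])
  have B: "cnj (1 - cnj \<alpha> * ?p w) = ?s / B"
    unfolding B_def one_minus_phi_aut[OF \<alpha>(1) w] by simp
  have AB: "1 - ?p z * cnj (?p w) = ?s * (1 - z * cnj w) / (A * B)"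
    unfolding A_def B_def by (rule one_minus_phi_aut_mult_cnj[OF \<alpha>(1) z w])
  have "norm (?p z * cnj (?p w)) < 1"
    using norm_mult_less_1[OF norm_phi_aut_less_1[OF \<alpha>(1) z] norm_phi_aut_less_1[OF \<alpha>(1) w]]
    by (simp add: norm_mult)
  from sums_mult[OF bergman_kernel_sums[OF this, of \<beta>], of "(?s / A * (?s / B)) ^ (\<beta> + 2)"]
  have "(\<lambda>n. (?s / A * (?s / B)) ^ (\<beta> + 2) * (of_real (1 / bergman_weight (real \<beta>) n) * (?p z * cnj (?p w)) ^ n))
      sums ((?s / A * (?s / B)) ^ (\<beta> + 2) * (1 / (1 - ?p z * cnj (?p w)) ^ (\<beta> + 2)))" .
  moreover have "(?s / A * (?s / B)) ^ (\<beta> + 2) * (1 / (1 - ?p z * cnj (?p w)) ^ (\<beta> + 2))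
      = (?s / (1 - z * cnj w)) ^ (\<beta> + 2)"
  proof -
    \<comment> \<open>The cancellation is checked on the bases, before raising to the power
      \<open>\<beta> + 2\<close>.\<close>
    have cancel: "x ^ k * (1 / c ^ k) = y ^ k" if "x = y * c" "c \<noteq> 0" for x y c :: complex and k
      using that by (simp add: power_mult_distrib)
    have "?s / A * (?s / B) = ?s / (1 - z * cnj w) * (?s * (1 - z * cnj w) / (A * B))"
      using nz by (simp add: field_simps)
    moreover have "?s * (1 - z * cnj w) / (A * B) \<noteq> 0" using nz by simp
    ultimately show ?thesis
      unfolding AB by (rule cancel)
  qed
  moreover have "(?s / A * (?s / B)) ^ (\<beta> + 2) * (of_real (1 / bergman_weight (real \<beta>) n) * (?p z * cnj (?p w)) ^ n)
      = of_real (1 / bergman_weight (real \<beta>) n) * mobius_basis n z * cnj (mobius_basis n w)" for n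
    unfolding mobius_basis_def complex_cnj_mult complex_cnj_power[of "1 - _"] A B
    by (simp only: complex_cnj_power power_mult_distrib mult_ac)
  ultimately show ?thesis
    by (simp only: power_divide of_real_power)
qed

text \<open>Comparing the kernel expansion in this system with the one in monomials. The sum runs
  over the index of the system, so the relation expresses its completeness in matrix form.\<close>

lemma taylor_coeff_mobius_basis:
  "(\<lambda>n. of_real (1 / bergman_weight (real \<beta>) n) * taylor_coeff (mobius_basis n) i * cnj (taylor_coeff (mobius_basis n) j))
    sums (if i = j then of_real ((1 - (norm \<alpha>)\<^sup>2) ^ (\<beta> + 2) / bergman_weight (real \<beta>) i) else 0)"
proof -
  \<comment> \<open>Any number strictly between
    \<open>norm (phi_aut \<alpha> 0) = norm \<alpha>\<close> and 1 would do. By continuity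
    \<open>phi_aut \<alpha>\<close> stays below \<open>q\<close> in norm near 0, which yields a
    geometric majorant uniform on a small disc.\<close>
  define q where "q = (1 + norm \<alpha>) / 2"
  have q: "0 < q" "q < 1" "norm \<alpha> < q" using \<alpha> by (simp_all add: q_def add_pos_nonneg)
  have "continuous_on unit_disc (phi_aut \<alpha>)"
    by (intro holomorphic_on_imp_continuous_on
        holomorphic_on_subset[OF phi_aut_holomorphic[OF \<alpha>(2)]] subset_ball
        less_imp_le[OF one_less_inverse_norm])
  then have "isCont (phi_aut \<alpha>) 0"
    by (simp add: continuous_on_eq_continuous_at)
  then have "((\<lambda>z. norm (phi_aut \<alpha> z)) \<longlongrightarrow> norm \<alpha>) (nhds 0)"
    unfolding continuous_within tendsto_at_iff_tendsto_nhds
    using tendsto_norm[where a = "phi_aut \<alpha> 0"] by (simp add: phi_aut_def[of \<alpha> 0])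
  then have "eventually (\<lambda>z. norm (phi_aut \<alpha> z) < q) (nhds 0)"
    using q by (intro order_tendstoD)
  then obtain r0 where r0: "0 < r0" "\<And>z. dist z 0 < r0 \<Longrightarrow> norm (phi_aut \<alpha> z) < q"
    unfolding eventually_nhds_metric by blast
  define r where "r = min r0 1"
  have r: "0 < r" using r0 by (simp add: r_def)
  have pq: "norm (phi_aut \<alpha> z) < q" "norm z < 1" if "z \<in> ball 0 r" for z
    using that r0(2)[of z] by (simp_all add: r_def)
  \<comment> \<open>The majorant converges because it is a multiple of the kernel series at
    \<open>q\<^sup>2 < 1\<close>.\<close>
  have "summable (\<lambda>n. complex_of_real (1 / bergman_weight (real \<beta>) n) * of_real (q\<^sup>2) ^ n)"
    using q by (intro sums_summable[OF bergman_kernel_sums]) (simp add: norm_power power_less_one_iff)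
  then have "summable (\<lambda>n. complex_of_real (1 / bergman_weight (real \<beta>) n * (q\<^sup>2) ^ n))"
    by simp
  then have "summable (\<lambda>n. 1 / bergman_weight (real \<beta>) n * (q\<^sup>2) ^ n)"
    by (simp only: summable_complex_of_real)
  then have "summable (\<lambda>n. (2 ^ (\<beta> + 2))\<^sup>2 * (1 / bergman_weight (real \<beta>) n * (q\<^sup>2) ^ n))"
    by (rule summable_mult)
  moreover have "(2 ^ (\<beta> + 2))\<^sup>2 * (1 / bergman_weight (real \<beta>) n * (q\<^sup>2) ^ n)
      = 1 / bergman_weight (real \<beta>) n * (2 ^ (\<beta> + 2) * q ^ n)\<^sup>2" for n
    by (simp only: power_mult_distrib power_mult[symmetric] mult_ac)
  ultimately have summ: "summable (\<lambda>n. 1 / bergman_weight (real \<beta>) n * (2 ^ (\<beta> + 2) * q ^ n)\<^sup>2)"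
    by (simp only:)
  show ?thesis
  proof (rule taylor_coeff_kernel[OF r _ _ _ summ])
    show "mobius_basis n holomorphic_on ball 0 r" for n
      by (intro holomorphic_on_subset[OF mobius_basis_holomorphic] subset_ball)
        (use one_less_inverse_norm in \<open>simp add: r_def min_def\<close>)
    show "norm (mobius_basis n z) \<le> 2 ^ (\<beta> + 2) * q ^ n" if "z \<in> ball 0 r" for n z
    proof -
      have "norm (1 - cnj \<alpha> * phi_aut \<alpha> z) \<le> norm (1::complex) + norm (cnj \<alpha> * phi_aut \<alpha> z)"
        by (rule norm_triangle_ineq4)
      also have "\<dots> \<le> 2"
        using norm_mult_less_1[OF \<alpha>(1) norm_phi_aut_less_1[OF \<alpha>(1) pq(2)[OF that]]]
        by (simp add: norm_mult)
      finally show ?thesis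
        unfolding mobius_basis_def norm_mult norm_power using pq(1)[OF that]
        by (intro mult_mono power_mono) auto
    qed
    show "0 \<le> 1 / bergman_weight (real \<beta>) n" for n
      using bergman_weight_pos[of \<beta> n] by simp
    fix z w :: complex assume "z \<in> ball 0 r" "w \<in> ball 0 r"
    note zw = pq(2)[OF this(1)] pq(2)[OF this(2)]
    show "(\<lambda>n. of_real (1 / bergman_weight (real \<beta>) n) * mobius_basis n z * cnj (mobius_basis n w))
      sums (of_real ((1 - (norm \<alpha>)\<^sup>2) ^ (\<beta> + 2)) / (1 - z * cnj w) ^ (\<beta> + 2))"
      by (rule mobius_basis_kernel[OF zw])
    have "norm (z * cnj w) < 1"
      using norm_mult_less_1[OF zw] by (simp add: norm_mult)
    from sums_mult[OF bergman_kernel_sums[OF this, of \<beta>], of "of_real ((1 - (norm \<alpha>)\<^sup>2) ^ (\<beta> + 2))"]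
    show "(\<lambda>i. of_real ((1 - (norm \<alpha>)\<^sup>2) ^ (\<beta> + 2) / bergman_weight (real \<beta>) i) * (z * cnj w) ^ i)
      sums (of_real ((1 - (norm \<alpha>)\<^sup>2) ^ (\<beta> + 2)) / (1 - z * cnj w) ^ (\<beta> + 2))"
      by simp
  qed
qed

text \<open>Rescaling Taylor coefficients by the square roots of the weights turns the space into
  unweighted square-summable sequences, where \<open>orthogonal_of_disjoint_spectra\<close>
  applies.\<close>

lemma A2_orthogonal_of_disjoint_mobius_spectra:
  assumes u: "u \<in> A2 (real \<beta>)" and w: "w \<in> A2 (real \<beta>)"
    and disj: "\<And>n. A2_inner (real \<beta>) (mobius_basis n) u = 0 \<or> A2_inner (real \<beta>) (mobius_basis n) w = 0"
  shows "A2_inner (real \<beta>) w u = 0"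
proof -
  define W where "W = bergman_weight (real \<beta>)"
  define rW where "rW = (\<lambda>n. complex_of_real (sqrt (W n)))"
  define s where "s = (1 - (norm \<alpha>)\<^sup>2) ^ (\<beta> + 2)"
  define rs where "rs = complex_of_real (sqrt s)"
  have W: "0 < W n" for n unfolding W_def by (rule bergman_weight_pos)
  have s: "0 < s" using \<alpha> by (simp add: s_def abs_square_less_1)
  have rW: "rW n * rW n = of_real (W n)" "rW n \<noteq> 0" "cnj (rW n) = rW n" for n
    using W[of n] by (simp_all add: rW_def flip: of_real_mult)
  have rs: "rs * rs = of_real s" "rs \<noteq> 0" "cnj rs = rs"
    using s by (simp_all add: rs_def flip: of_real_mult)
  \<comment> \<open>Row n is \<open>mobius_basis n\<close> in normalised monomial coordinates;
    dividing by \<open>rW n * rs\<close> is exactly what makes the columns orthonormal in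
    \<open>taylor_coeff_mobius_basis\<close>.\<close>
  define Q where "Q = (\<lambda>n i. inverse (rW n * rs) * (rW i * taylor_coeff (mobius_basis n) i))"
  have inner: "(\<Sum>i. Q n i * cnj (rW i * taylor_coeff f i))
      = inverse (rW n * rs) * A2_inner (real \<beta>) (mobius_basis n) f" if "f \<in> A2 (real \<beta>)" for n f
  proof -
    have "Q n i * cnj (rW i * taylor_coeff f i) = inverse (rW n * rs) *
        (of_real (W i) * taylor_coeff (mobius_basis n) i * cnj (taylor_coeff f i))" for i
      unfolding Q_def complex_cnj_mult rW(3) rW(1)[symmetric] by (simp only: mult_ac)
    then show ?thesis
      unfolding A2_inner_def W_def
      by (simp only: suminf_mult[OF A2_inner_summable[OF mobius_basis_A2 that]])
  qed
  have "(\<Sum>i. cnj (rW i * taylor_coeff u i) * (rW i * taylor_coeff w i)) = 0"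
  proof (rule orthogonal_of_disjoint_spectra[of Q])
    show "summable (\<lambda>i. (norm (rW i * taylor_coeff u i))\<^sup>2)" "summable (\<lambda>i. (norm (rW i * taylor_coeff w i))\<^sup>2)"
      unfolding rW_def W_def by (intro A2_square_summable u w)+
    show "(\<Sum>i. Q n i * cnj (rW i * taylor_coeff u i)) = 0 \<or> (\<Sum>i. Q n i * cnj (rW i * taylor_coeff w i)) = 0" for n
      using disj[of n] unfolding inner[OF u] inner[OF w] by auto
    show "summable (\<lambda>i. (norm (Q n i))\<^sup>2)" for n
    proof -
      have "summable (\<lambda>i. (norm (rW i * taylor_coeff (mobius_basis n) i))\<^sup>2)"
        unfolding rW_def W_def by (rule A2_square_summable[OF mobius_basis_A2])
      then show ?thesis
        unfolding Q_def norm_mult[of "inverse _"] power_mult_distrib[of "norm (inverse _)"]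
        by (rule summable_mult)
    qed
    show "(\<lambda>n. Q n i * cnj (Q n j)) sums (if i = j then 1 else 0)" for i j
    proof -
      have "Q n i * cnj (Q n j) = rW i * rW j / of_real s *
          (of_real (1 / W n) * taylor_coeff (mobius_basis n) i * cnj (taylor_coeff (mobius_basis n) j))" for n
        unfolding Q_def complex_cnj_mult complex_cnj_inverse rW(3) rs(3) of_real_divide
          rW(1)[symmetric] rs(1)[symmetric]
        using rW(2) rs(2) by (simp add: field_simps)
      moreover have "rW i * rW j / of_real s * (if i = j then of_real (s / W i) else 0) = (if i = j then 1 else 0)"
        using s W[of i] rW(1)[of j] by auto
      ultimately show ?thesis
        using sums_mult[OF taylor_coeff_mobius_basis[of i j], of "rW i * rW j / of_real s"]
        unfolding W_def[symmetric] s_def[symmetric] by (simp only:)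
    qed
  qed
  moreover have "cnj (rW i * taylor_coeff u i) * (rW i * taylor_coeff w i)
      = of_real (W i) * taylor_coeff w i * cnj (taylor_coeff u i)" for i
    unfolding complex_cnj_mult rW(3) rW(1)[symmetric] by (simp only: mult_ac)
  ultimately show ?thesis
    unfolding A2_inner_def W_def by (simp only:)
qed

text \<open>Each power in \<open>mobius_basis_expand\<close> is an eigenvector of composition with
  \<open>\<phi>\<close>, for an eigenvalue \<open>lam ^ (n + k)\<close> different from
  \<open>b\<close>, so every term of the expansion is orthogonal to \<open>u\<close>.\<close>

lemma A2_inner_mobius_basis_eq_0:
  assumes "is_adjoint (real \<beta>) (\<lambda>f. f \<circ> \<phi>) S" and u: "u \<in> A2 (real \<beta>)"
    and \<phi>: "\<And>z. z \<in> unit_disc \<Longrightarrow> phi_aut \<alpha> (\<phi> z) = lam * phi_aut \<alpha> z"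
    and "eq_disc (S u) (\<lambda>z. cnj b * u z)"
    and "\<And>k. k \<le> \<beta> + 2 \<Longrightarrow> lam ^ (n + k) \<noteq> b"
  shows "A2_inner (real \<beta>) (mobius_basis n) u = 0"
proof -
  have "A2_inner (real \<beta>) (\<lambda>z. phi_aut \<alpha> z ^ (n + k)) u = 0" if "k \<le> \<beta> + 2" for k
  proof (rule adjoint_eigenvector_orthogonal[OF assms(1) phi_aut_power_A2 u _ assms(4)])
    show "eq_disc (\<lambda>z. lam ^ (n + k) * phi_aut \<alpha> z ^ (n + k)) ((\<lambda>z. phi_aut \<alpha> z ^ (n + k)) \<circ> \<phi>)"
      by (simp add: eq_disc_def \<phi> power_mult_distrib)
    show "lam ^ (n + k) \<noteq> cnj (cnj b)"
      using assms(5)[OF that] by simp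
  qed
  then show ?thesis
    unfolding mobius_basis_expand A2_inner_sum_left[OF phi_aut_power_A2 u] by (intro sum.neutral) simp
qed

end

section \<open>Contradiction between a conjugation and the order of the multiplier\<close>

theorem theorem5p7:
  fixes \<beta> N :: nat and \<alpha> lam :: complex and \<phi> :: "complex \<Rightarrow> complex"
  assumes "\<alpha> \<in> unit_disc" and "\<alpha> \<noteq> 0"
    and "norm lam = 1"
    and "\<phi> = (\<lambda>z. phi_aut \<alpha> (lam * phi_aut \<alpha> z))"
    and "\<not> (\<exists>\<mu>. norm \<mu> = 1 \<and> (\<forall>z\<in>unit_disc. \<phi> z = \<mu> * z))"
    and "N > 0" and "lam ^ N = 1" and "\<forall>k. 0 < k \<and> k < N \<longrightarrow> lam ^ k \<noteq> 1"
    and "N \<ge> 2 * (3 + \<beta>)"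
  shows "\<not> complex_symmetric (real \<beta>) (\<lambda>f. f \<circ> \<phi>)"
proof
  assume "complex_symmetric (real \<beta>) (\<lambda>f. f \<circ> \<phi>)"
  then obtain C S where C: "is_conjugation (real \<beta>) C" and S: "is_adjoint (real \<beta>) (\<lambda>f. f \<circ> \<phi>) S"
    and CS: "\<And>f. f \<in> A2 (real \<beta>) \<Longrightarrow> eq_disc (C (f \<circ> \<phi>)) (S (C f))"
    unfolding complex_symmetric_def by blast
  have C_A2: "C f \<in> A2 (real \<beta>)"
    and C_scale: "eq_disc (C (\<lambda>z. a * f z)) (\<lambda>z. cnj a * C f z)"
    if "f \<in> A2 (real \<beta>)" for f a
    using C that unfolding is_conjugation_def by simp_all
  have C_cong: "eq_disc f g \<Longrightarrow> eq_disc (C f) (C g)"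
    and C_inner: "A2_inner (real \<beta>) (C f) (C g) = A2_inner (real \<beta>) g f"
    if "f \<in> A2 (real \<beta>)" "g \<in> A2 (real \<beta>)" for f g
    using C that unfolding is_conjugation_def by simp_all
  have \<alpha>: "norm \<alpha> < 1" "\<alpha> \<noteq> 0" using assms by simp_all
  note A2_power = phi_aut_power_A2[OF \<alpha>, of _ \<beta>]
  have \<phi>: "phi_aut \<alpha> (\<phi> z) = lam * phi_aut \<alpha> z" if "z \<in> unit_disc" for z
    unfolding \<open>\<phi> = _\<close> using norm_phi_aut_less_1[OF \<alpha>(1), of z] that \<open>norm lam = 1\<close>
    by (intro phi_aut_involution \<alpha>) (simp add: norm_mult)
  define v where "v = (\<lambda>m. C (\<lambda>z. phi_aut \<alpha> z ^ m))"
  have v_A2: "v m \<in> A2 (real \<beta>)" for m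
    unfolding v_def by (rule C_A2[OF A2_power])
  have eig: "eq_disc (S (v m)) (\<lambda>z. cnj (lam ^ m) * v m z)" for m
  proof -
    let ?f = "\<lambda>z. phi_aut \<alpha> z ^ m"
    have f\<phi>: "eq_disc (\<lambda>z. lam ^ m * ?f z) (?f \<circ> \<phi>)"
      by (simp add: eq_disc_def \<phi> power_mult_distrib)
    \<comment> \<open>Congruence of \<open>C\<close> needs both functions in the space; membership
      of \<open>?f \<circ> \<phi>\<close> is transferred from this multiple, with which it agrees on
      the disc.\<close>
    have "(\<lambda>z. lam ^ m * ?f z) \<in> A2 (real \<beta>)"
      by (intro A2_of_holomorphic_on_larger_disc[OF _ one_less_inverse_norm[OF \<alpha>]] holomorphic_intros
          phi_aut_holomorphic \<alpha>)
    then have "eq_disc (C (\<lambda>z. lam ^ m * ?f z)) (C (?f \<circ> \<phi>))"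
      by (intro C_cong A2_eq_disc[OF _ f\<phi>] f\<phi>)
    moreover have "eq_disc (C (\<lambda>z. lam ^ m * ?f z)) (\<lambda>z. cnj (lam ^ m) * C ?f z)"
      by (rule C_scale[OF A2_power])
    ultimately show ?thesis
      using CS[OF A2_power[of m]] by (simp add: eq_disc_def v_def)
  qed
  have "A2_inner (real \<beta>) (v (\<beta> + 3)) (v 0) = 0"
  proof (rule A2_orthogonal_of_disjoint_mobius_spectra[OF \<alpha> v_A2 v_A2], rule ccontr)
    fix n
    assume *: "\<not> (A2_inner (real \<beta>) (mobius_basis \<beta> \<alpha> n) (v 0) = 0
        \<or> A2_inner (real \<beta>) (mobius_basis \<beta> \<alpha> n) (v (\<beta> + 3)) = 0)"
    have "\<exists>k\<le>\<beta>+2. lam ^ (n + k) = lam ^ m" if "A2_inner (real \<beta>) (mobius_basis \<beta> \<alpha> n) (v m) \<noteq> 0" for m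
      using that A2_inner_mobius_basis_eq_0[OF \<alpha> S v_A2 \<phi> eig] by blast
    with * obtain i j where ij: "i \<le> \<beta> + 2" "lam ^ (n + i) = lam ^ 0"
      "j \<le> \<beta> + 2" "lam ^ (n + j) = lam ^ (\<beta> + 3)"
      by blast
    \<comment> \<open>Eliminates the unknown n from the two coincidences of eigenvalues.\<close>
    have "lam ^ j * lam ^ (n + i) = lam ^ i * lam ^ (n + j)"
      by (simp add: power_add)
    then have "lam ^ j = lam ^ i * lam ^ (\<beta> + 3)"
      unfolding ij by simp
    also have "\<dots> = lam ^ (\<beta> + 3 + i - j) * lam ^ j"
      using ij by (simp flip: power_add add: add.commute)
    finally have "lam ^ (\<beta> + 3 + i - j) = 1"
      using \<open>norm lam = 1\<close> by auto
    \<comment> \<open>Since \<open>i\<close> and \<open>j\<close> are at most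
      \<open>\<beta> + 2\<close>, the exponent lies between 1 and \<open>2 * \<beta> + 5\<close>.
      The choice of \<open>\<beta> + 3\<close> gives the lower bound, and the hypothesis on
      \<open>N\<close> puts the upper bound below \<open>N\<close>.\<close>
    moreover have "0 < \<beta> + 3 + i - j" "\<beta> + 3 + i - j < N"
      using ij assms by auto
    ultimately show False
      using assms by blast
  qed
  moreover have "A2_inner (real \<beta>) (v (\<beta> + 3)) (v 0)
      = A2_inner (real \<beta>) (\<lambda>z. phi_aut \<alpha> z ^ 0) (\<lambda>z. phi_aut \<alpha> z ^ (\<beta> + 3))"
    unfolding v_def by (rule C_inner[OF A2_power A2_power])
  moreover have "A2_inner (real \<beta>) (\<lambda>z. phi_aut \<alpha> z ^ 0) (\<lambda>z. phi_aut \<alpha> z ^ (\<beta> + 3)) = cnj \<alpha> ^ (\<beta> + 3)"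
  proof -
    let ?g = "\<lambda>n. of_real (bergman_weight (real \<beta>) n) * taylor_coeff (\<lambda>z. phi_aut \<alpha> z ^ 0) n
        * cnj (taylor_coeff (\<lambda>z. phi_aut \<alpha> z ^ (\<beta> + 3)) n)"
    \<comment> \<open>The zeroth power is the constant 1, so only the constant coefficients
      contribute; the weight at 0 is 1 and \<open>phi_aut \<alpha> 0 = \<alpha>\<close>.\<close>
    have "?g n = 0" if "n \<noteq> 0" for n
      using that by (simp add: taylor_coeff_def)
    then have "(\<Sum>n. ?g n) = (\<Sum>n\<in>{0}. ?g n)"
      by (intro suminf_finite) auto
    then show ?thesis
      unfolding A2_inner_def
      by (simp add: taylor_coeff_def phi_aut_def bergman_weight_of_nat)
  qed
  ultimately show False
    using \<alpha>(2) by simp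
qed

end
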